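(* Let $M\in S_d^+$ with $\det M=1$. Then for each $\delta>0$, $$\mathcal P(\lambda_1(R^TMR)\le\delta)\le C'(d)\,\delta^d,$$ where $C'(d):=2d\,3^{d-1}C(d)$, $C(d)=2^d/\omega_d$, and $\omega_d$ is the volume of the $d$-dimensional Euclidean unit ball.
   Context: $S_d^+$ is the set of $d\times d$ symmetric positive definite matrices; $\|x\|_M:=\sqrt{x^TMx}$. $\lambda_1(M):=\min_{u\in\mathbb Z^d\setminus\{0\}}\|u\|_M$. $R$ is a random matrix in the orthogonal group $\mathcal O_d$ distributed according to the Haar probability measure, and $\mathcal P$ denotes probability. *)

theory Defs
  imports "HOL-Analysis.Analysis" "HOL-Probability.Probability"
begin

text \<open>Symmetric positive definite matrices S_d^+.\<close>
definition sym_posdef :: "real^'n^'n \<Rightarrow> bool" where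
  "sym_posdef A \<longleftrightarrow> transpose A = A \<and> (\<forall>x. x \<noteq> 0 \<longrightarrow> x \<bullet> (A *v x) > 0)"

text \<open>The norm induced by A: sqrt (x^T A x).\<close>
definition mnorm :: "real^'n^'n \<Rightarrow> real^'n \<Rightarrow> real" where
  "mnorm A x = sqrt (x \<bullet> (A *v x))"

text \<open>Integer lattice Z^d.\<close>
definition int_vecs :: "(real^'n) set" where
  "int_vecs = {u. \<forall>i. u $ i \<in> \<int>}"

text \<open>First successive minimum lambda_1(A) = min over nonzero integer u of mnorm A u.\<close>
definition lambda1 :: "real^'n^'n \<Rightarrow> real" where
  "lambda1 A = Inf {mnorm A u | u. u \<in> int_vecs \<and> u \<noteq> 0}"

text \<open>Haar probability measure on O_d, viewed as a Borel measure on d x d matrices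
  concentrated on the orthogonal group and invariant under left multiplication by
  orthogonal matrices (this characterises the Haar measure uniquely).\<close>
definition haar_orthogonal :: "(real^'n^'n) measure \<Rightarrow> bool" where
  "haar_orthogonal P \<longleftrightarrow>
     prob_space P \<and> sets P = sets borel \<and>
     measure P {R. orthogonal_matrix R} = 1 \<and>
     (\<forall>Q. orthogonal_matrix Q \<longrightarrow> distr P borel (\<lambda>R. Q ** R) = P)"

text \<open>omega_d: volume of the d-dimensional Euclidean unit ball.\<close>
definition omega :: "'n::finite itself \<Rightarrow> real" where
  "omega _ = measure lborel (ball (0::real^'n) 1)"

definition C_const :: "'n::finite itself \<Rightarrow> real" where
  "C_const n = 2 ^ CARD('n) / omega n"

definition C'_const :: "'n::finite itself \<Rightarrow> real" where
  "C'_const n = 2 * real CARD('n) * 3 ^ (CARD('n) - 1) * C_const n"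

end

theory Submission
  imports Defs
begin

text \<open>
  Fix r > \<delta> and let E = {y. y \<bullet> (A *v y) \<le> r^2}. If lambda1 (R^T A R) \<le> \<delta>, then R u \<in> E
  for some nonzero integer vector u, so the probability is at most the sum over u \<in> Z^d - {0} of
  G u = P(R u \<in> E). Haar measure is also right invariant, hence G u depends only on the norm of u
  and decreases with it. Its superlevel sets are therefore centred balls, and packing disjoint balls
  of radius 1/2 around lattice points bounds the number of nonzero lattice points in such a ball by
  2 d 3^(d-1) / omega_d times its volume. Integrating over the levels gives
  sum G \<le> 2 d 3^(d-1) / omega_d * integral G, and by Fubini integral G is the expected volume of the
  ellipsoid R^-1 E, which is omega_d r^d because det A = 1. This bounds the probability by
  2 d 3^(d-1) r^d; let r tend to \<delta> and use omega_d \<le> 2^d.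
\<close>

section \<open>Volumes of linear images and ellipsoids\<close>

lemma measure_swap_coordinates_image:
  fixes S :: "(real^'n) set" and m n :: 'n
  assumes S: "S \<in> lmeasurable"
  defines "h \<equiv> \<lambda>x::real^'n. \<chi> i. x $ Transposition.transpose m n i"
  shows "h ` S \<in> lmeasurable \<and> measure lebesgue (h ` S) = measure lebesgue S"
proof -
  have lin: "linear h"
    by (rule linearI) (simp_all add: h_def vec_eq_iff)
  have "measure lebesgue (h ` cbox a b) = measure lebesgue (cbox a b)" for a b
  proof (cases "cbox a b = {}")
    case False
    have box: "h ` cbox a b = cbox (h a) (h b)"
      by (auto simp: h_def image_iff lambda_swap_Galois mem_box_cart) (metis transpose_involutory)+
    with False have ne: "cbox (h a) (h b) \<noteq> {}"
      by auto
    have "measure lebesgue (h ` cbox a b) = measure lebesgue (cbox (h a) (h b))"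
      by (simp add: box)
    also have "\<dots> = (\<Prod>i\<in>UNIV. b $ i - a $ i)"
      using content_cbox_cart[OF ne] prod.permute[OF permutes_swap_id, where S=UNIV and g="\<lambda>i. (b - a) $ i"]
      by (simp add: h_def)
    also have "\<dots> = measure lebesgue (cbox a b)"
      using content_cbox_cart[OF False] by simp
    finally show ?thesis .
  qed simp
  then show ?thesis
    using measure_linear_sufficient[OF lin S, of 1] by simp
qed

lemma measure_shear_image:
  fixes S :: "(real^'n) set" and m n :: 'n
  assumes S: "S \<in> lmeasurable" and "m \<noteq> n"
  defines "h \<equiv> \<lambda>x::real^'n. \<chi> i. if i = m then x $ m + x $ n else x $ i"
  shows "h ` S \<in> lmeasurable \<and> measure lebesgue (h ` S) = measure lebesgue S"
proof -
  have lin: "linear h"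
    by (rule linearI) (auto simp: h_def vec_eq_iff algebra_simps)
  have "measure lebesgue (h ` cbox a b) = measure lebesgue (cbox a b)" for a b
  proof (cases "cbox a b = {}")
    case False
    define v :: "real^'n" where "v = (\<chi> i. if i = n then a $ n else 0)"
    have "h ` cbox a b = (+) (h v) ` h ` cbox (- v + a) (- v + b)"
      unfolding cbox_translation image_comp
      by (rule image_cong) (simp_all add: linear_add[OF lin, symmetric])
    then have "measure lebesgue (h ` cbox a b) = measure lebesgue (h ` cbox (- v + a) (- v + b))"
      by (simp add: measure_translation)
    also have "\<dots> = measure lebesgue (cbox (- v + a) (- v + b))"
      unfolding h_def using \<open>m \<noteq> n\<close> False
      by (intro measure_shear_interval) (auto simp only: v_def cbox_translation image_is_empty, simp)
    also have "\<dots> = measure lebesgue (cbox a b)"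
      by (metis cbox_translation measure_translation)
    finally show ?thesis .
  qed simp
  then show ?thesis
    using measure_linear_sufficient[OF lin S, of 1] by simp
qed

text \<open>The library proves this as measure_linear_image only for index types of sort wellorder;
  the induction over elementary matrices does not need that restriction.\<close>

lemma measure_linear_image_cart:
  fixes f :: "real^'n \<Rightarrow> real^'n"
  assumes "linear f" "S \<in> lmeasurable"
  shows "f ` S \<in> lmeasurable \<and> measure lebesgue (f ` S) = \<bar>det (matrix f)\<bar> * measure lebesgue S"
proof -
  have "\<forall>S \<in> lmeasurable. f ` S \<in> lmeasurable \<and> measure lebesgue (f ` S) = \<bar>det (matrix f)\<bar> * measure lebesgue S"
    (is "?Q f")
  proof (rule induct_linear_elementary[OF \<open>linear f\<close>])
    fix f g :: "real^'n \<Rightarrow> real^'n"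
    assume "linear f" "linear g" and f: "?Q f" and g: "?Q g"
    show "?Q (f \<circ> g)"
    proof
      fix S :: "(real^'n) set"
      assume S: "S \<in> lmeasurable"
      then have "g ` S \<in> lmeasurable"
        using g by blast
      then show "(f \<circ> g) ` S \<in> lmeasurable \<and>
          measure lebesgue ((f \<circ> g) ` S) = \<bar>det (matrix (f \<circ> g))\<bar> * measure lebesgue S"
        using f g S matrix_compose[OF \<open>linear g\<close> \<open>linear f\<close>]
        unfolding image_comp[symmetric] by (simp add: det_mul abs_mult)
    qed
  next
    fix f :: "real^'n \<Rightarrow> real^'n" and i
    assume f: "linear f" "\<And>x. f x $ i = 0"
    then have "\<not> inj f"
      by (metis linear_injective_imp_surjective one_neq_zero surjE vec_component)
    then have "det (matrix f) = 0" "\<And>S. negligible (f ` S)"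
      using det_nz_iff_inj[OF \<open>linear f\<close>] negligible_linear_singular_image[OF \<open>linear f\<close>] by auto
    then show "?Q f"
      by (simp add: negligible_imp_measurable negligible_imp_measure0)
  next
    fix c :: "'n \<Rightarrow> real"
    show "?Q (\<lambda>x. \<chi> i. c i * x $ i)"
      by (simp add: measurable_stretch measure_stretch axis_def matrix_def det_diagonal)
  next
    fix m n :: 'n
    assume "m \<noteq> n"
    have "matrix (\<lambda>x::real^'n. \<chi> i. x $ Transposition.transpose m n i)
        = (\<chi> i. mat 1 $ Transposition.transpose m n i)"
      by (auto simp: matrix_def axis_def mat_def vec_eq_iff)
    then have "\<bar>det (matrix (\<lambda>x::real^'n. \<chi> i. x $ Transposition.transpose m n i))\<bar> = 1"
      by (simp add: det_permute_rows[OF permutes_swap_id] sign_swap_id abs_mult)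
    then show "?Q (\<lambda>x. \<chi> i. x $ Transposition.transpose m n i)"
      using measure_swap_coordinates_image by auto
  next
    fix m n :: 'n
    assume "m \<noteq> n"
    have "matrix (\<lambda>x::real^'n. \<chi> i. if i = m then x $ m + x $ n else x $ i)
        = (\<chi> k. if k = m then row m (mat 1) + 1 *s row n (mat 1) else row k (mat 1))"
      using \<open>m \<noteq> n\<close> by (auto simp: matrix_def axis_def mat_def row_def vec_eq_iff)
    then have "det (matrix (\<lambda>x::real^'n. \<chi> i. if i = m then x $ m + x $ n else x $ i)) = 1"
      using det_row_operation[OF \<open>m \<noteq> n\<close>, of "mat 1" 1] by simp
    then show "?Q (\<lambda>x. \<chi> i. if i = m then x $ m + x $ n else x $ i)"
      using measure_shear_image[OF _ \<open>m \<noteq> n\<close>] by simp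
  qed
  with assms show ?thesis
    by blast
qed

lemma borel_measurable_matrix_vector_mult[measurable (raw)]:
  fixes f :: "'a \<Rightarrow> real^'n^'m" and g :: "'a \<Rightarrow> real^'n"
  assumes "f \<in> borel_measurable M" "g \<in> borel_measurable M"
  shows "(\<lambda>x. f x *v g x) \<in> borel_measurable M"
  using assms by (rule borel_measurable_continuous_Pair)
    (unfold matrix_vector_mult_def, intro continuous_on_vec_lambda continuous_intros)

lemma borel_measurable_matrix_matrix_mult[measurable (raw)]:
  fixes f :: "'a \<Rightarrow> real^'n^'m" and g :: "'a \<Rightarrow> real^'k^'n"
  assumes "f \<in> borel_measurable M" "g \<in> borel_measurable M"
  shows "(\<lambda>x. f x ** g x) \<in> borel_measurable M"
  using assms by (rule borel_measurable_continuous_Pair)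
    (unfold matrix_matrix_mult_def, intro continuous_on_vec_lambda continuous_intros)

lemma borel_measurable_transpose[measurable (raw)]:
  fixes f :: "'a \<Rightarrow> real^'n^'m"
  assumes "f \<in> borel_measurable M"
  shows "(\<lambda>x. transpose (f x)) \<in> borel_measurable M"
  using _ assms by (rule borel_measurable_continuous_on)
    (unfold transpose_def, intro continuous_on_vec_lambda continuous_intros)

lemma orthogonal_matrices_borel[measurable]:
  "{R::real^'n^'n. orthogonal_matrix R} \<in> sets borel"
proof -
  have "closed {R::real^'n^'n. transpose R ** R = mat 1}"
    unfolding matrix_matrix_mult_def transpose_def
    by (intro closed_Collect_eq continuous_on_vec_lambda continuous_intros)
  then show ?thesis
    by (simp add: orthogonal_matrix borel_closed)
qed

definition ellipsoid :: "real^'n^'n \<Rightarrow> real \<Rightarrow> (real^'n) set" where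
  "ellipsoid A r = {x. x \<bullet> (A *v x) \<le> r\<^sup>2}"

lemma ellipsoid_borel [measurable]: "ellipsoid A r \<in> sets borel"
  unfolding ellipsoid_def by measurable

lemma inner_congruence:
  fixes A :: "real^'m^'m" and R :: "real^'n^'m"
  shows "(R *v x) \<bullet> (A *v (R *v x)) = x \<bullet> ((transpose R ** A ** R) *v x)"
  using dot_lmul_matrix[of x "transpose R" "A *v (R *v x)"] by (simp add: matrix_vector_mul_assoc matrix_mul_assoc)

lemma vimage_ellipsoid: "(*v) R -` ellipsoid A r = ellipsoid (transpose R ** A ** R) r"
  by (simp only: ellipsoid_def vimage_def mem_Collect_eq inner_congruence)

lemma sym_posdef_orthogonal_congruence:
  fixes A R :: "real^'n^'n"
  assumes "sym_posdef A" "orthogonal_matrix R"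
  shows "sym_posdef (transpose R ** A ** R)" "det (transpose R ** A ** R) = det A"
proof -
  have "R *v x \<noteq> 0" if "x \<noteq> 0" for x
    using assms(2) that by (metis matrix_vector_mul_assoc matrix_vector_mul_lid matrix_vector_mult_0_right orthogonal_matrix)
  then show "sym_posdef (transpose R ** A ** R)"
    using assms(1) by (auto simp: sym_posdef_def matrix_transpose_mul matrix_mul_assoc inner_congruence[symmetric])
  have "det R * det R = 1"
    using det_orthogonal_matrix[OF assms(2)] by auto
  then show "det (transpose R ** A ** R) = det A"
    by (simp add: det_mul algebra_simps)
qed

lemma scaleR_mem_ellipsoid:
  assumes "sym_posdef A" "x \<in> ellipsoid A r" "\<bar>t\<bar> \<le> 1"
  shows "t *\<^sub>R x \<in> ellipsoid A r"
proof -
  have "0 \<le> x \<bullet> (A *v x)"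
    using assms(1) by (cases "x = 0") (auto simp: sym_posdef_def less_imp_le)
  moreover have "t\<^sup>2 \<le> 1"
    using assms(3) abs_le_square_iff[of t 1] by simp
  ultimately have "t\<^sup>2 * (x \<bullet> (A *v x)) \<le> x \<bullet> (A *v x)"
    by (simp add: mult_left_le_one_le)
  then show ?thesis
    using assms(2) by (simp add: ellipsoid_def matrix_vector_mult_scaleR power2_eq_square)
qed

lemma sym_matrix_inner_commute:
  fixes A :: "real^'n^'n"
  assumes "transpose A = A"
  shows "x \<bullet> (A *v y) = y \<bullet> (A *v x)"
  by (metis assms dot_lmul_matrix inner_commute transpose_transpose vector_transpose_matrix)

lemma sym_posdef_orthonormal_set:
  fixes A :: "real^'n^'n"
  assumes "sym_posdef A" "k \<le> CARD('n)"
  obtains S where "finite S" "card S = k" "\<And>x y. x \<in> S \<Longrightarrow> y \<in> S \<Longrightarrow> x \<bullet> (A *v y) = of_bool (x = y)"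
  using assms(2)
proof (induction k arbitrary: thesis)
  case 0
  then show ?case by (metis card.empty empty_iff finite.emptyI)
next
  case (Suc k)
  then obtain S where S: "finite S" "card S = k"
    and on: "\<And>x y. x \<in> S \<Longrightarrow> y \<in> S \<Longrightarrow> x \<bullet> (A *v y) = of_bool (x = y)"
    by auto
  have sym: "transpose A = A" and pos: "\<And>x. x \<noteq> 0 \<Longrightarrow> x \<bullet> (A *v x) > 0"
    using assms(1) by (auto simp: sym_posdef_def)
  have "dim ((*v) A ` S) \<le> card ((*v) A ` S)"
    using S by (intro dim_le_card') auto
  also have "\<dots> \<le> card S"
    using S by (intro card_image_le) auto
  also have "\<dots> < DIM(real^'n)"
    using S Suc.prems by simp
  finally obtain x where x: "x \<noteq> 0" "\<And>y. y \<in> span ((*v) A ` S) \<Longrightarrow> orthogonal x y"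
    using orthogonal_to_subspace_exists by blast
  have xS: "x \<bullet> (A *v s) = 0" if "s \<in> S" for s
    using x(2)[of "A *v s"] that by (auto simp: orthogonal_def span_base)
  define x' where "x' = (1 / sqrt (x \<bullet> (A *v x))) *\<^sub>R x"
  have x'x': "x' \<bullet> (A *v x') = 1"
    using pos[OF x(1)] by (simp add: x'_def matrix_vector_mult_scaleR)
  have x'S: "x' \<bullet> (A *v s) = 0" "s \<bullet> (A *v x') = 0" if "s \<in> S" for s
    using xS[OF that] sym_matrix_inner_commute[OF sym, of s x'] by (simp_all add: x'_def)
  have "x' \<notin> S"
    using x'x' x'S by force
  show ?case
  proof (rule Suc.prems(1)[of "insert x' S"])
    fix y z assume "y \<in> insert x' S" "z \<in> insert x' S"
    then show "y \<bullet> (A *v z) = of_bool (y = z)"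
      using on x'x' x'S by auto
  qed (use S \<open>x' \<notin> S\<close> in auto)
qed

lemma sym_posdef_congruent_identity:
  fixes A :: "real^'n^'n"
  assumes "sym_posdef A"
  obtains V :: "real^'n^'n" where "transpose V ** A ** V = mat 1"
proof -
  obtain S where S: "finite S" "card S = CARD('n)"
    and on: "\<And>x y. x \<in> S \<Longrightarrow> y \<in> S \<Longrightarrow> x \<bullet> (A *v y) = of_bool (x = y)"
    using sym_posdef_orthonormal_set[OF assms order.refl] by blast
  obtain g where g: "bij_betw g (UNIV::'n set) S"
    using finite_same_card_bij[of "UNIV::'n set" S] S by auto
  define V :: "real^'n^'n" where "V = (\<chi> i j. g j $ i)"
  have "(transpose V ** A ** V) $ j $ k = g j \<bullet> (A *v g k)" for j k
    by (simp add: V_def matrix_matrix_mult_def matrix_vector_mult_def inner_vec_def transpose_def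
        sum_distrib_left sum_distrib_right mult.assoc mult.left_commute)
      (subst sum.swap, simp add: mult.commute mult.left_commute)
  moreover have "g j \<in> S" "g j = g k \<longleftrightarrow> j = k" for j k
    using g by (auto simp: bij_betw_def inj_on_def)
  ultimately have "transpose V ** A ** V = mat 1"
    using on by (simp add: vec_eq_iff mat_def)
  then show ?thesis
    by (rule that)
qed

lemma measure_ball_omega:
  "r \<ge> 0 \<Longrightarrow> measure lborel (ball (c::real^'n) r) = r ^ CARD('n) * omega TYPE('n)"
  unfolding omega_def using content_ball_conv_unit_ball[of r c] by simp

lemma measure_cball_omega:
  "r \<ge> 0 \<Longrightarrow> measure lborel (cball (c::real^'n) r) = r ^ CARD('n) * omega TYPE('n)"
  using measure_ball_omega[of r c] content_cball_conv_ball[of c r] by simp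

lemma omega_pos: "omega TYPE('n::finite) > 0"
  unfolding omega_def using content_ball_pos[of 1 "0::real^'n"] by simp

lemma emeasure_ellipsoid:
  fixes A :: "real^'n^'n"
  assumes "sym_posdef A" "det A = 1" "r \<ge> 0"
  shows "emeasure lborel (ellipsoid A r) = ennreal (r ^ CARD('n) * omega TYPE('n))"
proof -
  obtain V :: "real^'n^'n" where V: "transpose V ** A ** V = mat 1"
    using sym_posdef_congruent_identity[OF assms(1)] by blast
  then have "(det V)\<^sup>2 = 1"
    using assms(2) by (metis det_I det_mul det_transpose mult.commute mult_1 power2_eq_square)
  then have "\<bar>det V\<bar> = 1" and "invertible V"
    by (auto simp: invertible_det_nz power2_eq_1_iff)
  have quad: "(V *v y) \<bullet> (A *v (V *v y)) = (norm y)\<^sup>2" for y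
    using inner_congruence[where R=V and A=A and x=y] V by (simp add: power2_norm_eq_inner)
  have E: "ellipsoid A r = (*v) V ` cball 0 r"
  proof (intro set_eqI iffI)
    fix x assume "x \<in> ellipsoid A r"
    moreover obtain y where "x = V *v y"
      using \<open>invertible V\<close> by (metis invertible_def matrix_vector_mul_assoc matrix_vector_mul_lid)
    ultimately show "x \<in> (*v) V ` cball 0 r"
      using quad[of y] assms(3) by (auto simp: ellipsoid_def power2_le_iff_abs_le)
  next
    fix x assume "x \<in> (*v) V ` cball 0 r"
    then show "x \<in> ellipsoid A r"
      using quad by (auto simp: ellipsoid_def power_mono)
  qed
  have "(*v) V ` cball 0 r \<in> lmeasurable \<and>
      measure lebesgue ((*v) V ` cball 0 r) = \<bar>det V\<bar> * measure lebesgue (cball (0::real^'n) r)"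
    using measure_linear_image_cart[OF matrix_vector_mul_linear, of "cball 0 r" V]
    by (simp add: matrix_of_matrix_vector_mul)
  then have "ellipsoid A r \<in> lmeasurable"
    and vol: "measure lebesgue (ellipsoid A r) = r ^ CARD('n) * omega TYPE('n)"
    unfolding E using \<open>\<bar>det V\<bar> = 1\<close> assms(3) by (simp_all add: measure_cball_omega)
  moreover have "emeasure lborel (ellipsoid A r) = emeasure lebesgue (ellipsoid A r)"
    using ellipsoid_borel[of A r] by simp
  ultimately show ?thesis
    by (simp add: emeasure_eq_measure2 vol)
qed

section \<open>Lattice points in balls\<close>

lemma int_vecs_norm_diff_ge_1:
  fixes u v :: "real^'n"
  assumes "u \<in> int_vecs" "v \<in> int_vecs" "u \<noteq> v"
  shows "1 \<le> norm (u - v)"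
proof -
  obtain i where "u $ i \<noteq> v $ i"
    using assms(3) by (auto simp: vec_eq_iff)
  moreover have "u $ i - v $ i \<in> \<int>"
    using assms(1,2) by (simp add: int_vecs_def)
  ultimately have "1 \<le> \<bar>(u - v) $ i\<bar>"
    by (metis Ints_nonzero_abs_ge1 right_minus_eq vector_minus_component)
  also have "\<dots> \<le> norm (u - v)"
    by (rule component_le_norm_cart)
  finally show ?thesis .
qed

lemma countable_int_vecs: "countable (int_vecs :: (real^'n) set)"
proof -
  have "int_vecs = (\<lambda>f. \<chi> i. of_int (f i)) ` (UNIV :: ('n \<Rightarrow> int) set)"
  proof (intro set_eqI iffI)
    fix u :: "real^'n"
    assume "u \<in> int_vecs"
    then have "\<forall>i. \<exists>k::int. u $ i = of_int k"
      by (auto simp: int_vecs_def elim!: Ints_cases)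
    then obtain f where "\<And>i. u $ i = of_int (f i)"
      by metis
    then show "u \<in> (\<lambda>f. \<chi> i. of_int (f i)) ` UNIV"
      by (auto simp: vec_eq_iff intro!: image_eqI[of _ _ f])
  qed (auto simp: int_vecs_def)
  moreover have "countable (UNIV :: ('n \<Rightarrow> int) set)"
    using countable_PiE[of "UNIV :: 'n set" "\<lambda>_. UNIV :: int set"] by (simp add: PiE_UNIV_domain)
  ultimately show ?thesis
    by (metis countable_image)
qed

lemma power_two_mul_plus_one_minus_one_le:
  fixes m :: real
  assumes "m \<ge> 1" "d \<ge> 1"
  shows "(2 * m + 1) ^ d - 1 \<le> 2 * real d * 3 ^ (d - 1) * m ^ d"
proof -
  have "(2 * m + 1) ^ d - 1 = 2 * m * (\<Sum>i<d. (2 * m + 1) ^ i)"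
    using power_diff_1_eq[of "2 * m + 1" d] by simp
  also have "\<dots> \<le> 2 * m * (\<Sum>i<d. (3 * m) ^ (d - 1))"
  proof (intro mult_left_mono sum_mono)
    fix i assume "i \<in> {..<d}"
    have "(2 * m + 1) ^ i \<le> (3 * m) ^ i"
      using assms by (intro power_mono) auto
    also have "\<dots> \<le> (3 * m) ^ (d - 1)"
      using assms \<open>i \<in> {..<d}\<close> by (intro power_increasing) auto
    finally show "(2 * m + 1) ^ i \<le> (3 * m) ^ (d - 1)" .
  qed (use assms in auto)
  also have "\<dots> = 2 * real d * 3 ^ (d - 1) * (m * m ^ (d - 1))"
    by (simp add: power_mult_distrib)
  also have "m * m ^ (d - 1) = m ^ d"
    using assms(2) by (simp add: power_eq_if)
  finally show ?thesis .
qed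

lemma card_separated_points_le:
  fixes W :: "(real^'n) set"
  assumes "finite W" and sep: "\<And>u v. u \<in> W \<Longrightarrow> v \<in> W \<Longrightarrow> u \<noteq> v \<Longrightarrow> 1 \<le> dist u v"
    and "W \<subseteq> cball 0 m" "m \<ge> 0"
  shows "real (card W) \<le> (2 * m + 1) ^ CARD('n)"
proof -
  have "disjoint_family_on (\<lambda>w. ball w (1/2)) W"
    unfolding disjoint_family_on_def
  proof (intro ballI impI)
    fix u v assume "u \<in> W" "v \<in> W" "u \<noteq> v"
    show "ball u (1/2) \<inter> ball v (1/2) = {}"
    proof (intro equals0I)
      fix x assume "x \<in> ball u (1/2) \<inter> ball v (1/2)"
      then have "dist u v < 1"
        using dist_triangle_half_l[of u x 1 v] by simp
      with sep[OF \<open>u \<in> W\<close> \<open>v \<in> W\<close> \<open>u \<noteq> v\<close>] show False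
        by simp
    qed
  qed
  then have "measure lborel (\<Union>w\<in>W. ball w (1/2)) = (\<Sum>w\<in>W. measure lborel (ball w (1/2::real)))"
    using \<open>finite W\<close> emeasure_lborel_ball_finite[where 'a="real^'n"]
    by (intro measure_finite_Union) (auto simp: less_top)
  also have "\<dots> = real (card W) * ((1/2) ^ CARD('n) * omega TYPE('n))"
    by (simp add: measure_ball_omega)
  finally have union: "measure lborel (\<Union>w\<in>W. ball w (1/2)) = real (card W) * ((1/2) ^ CARD('n) * omega TYPE('n))" .
  have "(\<Union>w\<in>W. ball w (1/2)) \<subseteq> ball 0 (m + 1/2)"
  proof (intro UN_least subsetI)
    fix w x assume "w \<in> W" "x \<in> ball w (1/2)"
    then show "x \<in> ball 0 (m + 1/2)"
      using \<open>W \<subseteq> cball 0 m\<close> dist_triangle[of 0 x w] by auto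
  qed
  then have "measure lborel (\<Union>w\<in>W. ball w (1/2)) \<le> measure lborel (ball (0::real^'n) (m + 1/2))"
    using emeasure_lborel_ball_finite[where 'a="real^'n"]
    by (intro measure_mono_fmeasurable) (auto simp: fmeasurable_def less_top intro!: borel_open open_UN)
  also have "\<dots> = (m + 1/2) ^ CARD('n) * omega TYPE('n)"
    using \<open>m \<ge> 0\<close> by (simp add: measure_ball_omega)
  finally have "real (card W) * (1/2) ^ CARD('n) \<le> (m + 1/2) ^ CARD('n)"
    using union omega_pos[where 'n='n] by (simp add: mult.assoc[symmetric])
  then have "real (card W) * (1/2) ^ CARD('n) * 2 ^ CARD('n) \<le> (m + 1/2) ^ CARD('n) * 2 ^ CARD('n)"
    by (intro mult_right_mono) auto
  then show ?thesis
    by (simp add: power_mult_distrib[symmetric] algebra_simps)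
qed

lemma card_nonzero_int_vecs_le:
  fixes W :: "(real^'n) set"
  assumes "finite W" "W \<subseteq> int_vecs - {0}" "W \<subseteq> cball 0 m" "m \<ge> 1"
  shows "real (card W) \<le> 2 * real CARD('n) * 3 ^ (CARD('n) - 1) * m ^ CARD('n)"
proof -
  have "real (card (insert 0 W)) \<le> (2 * m + 1) ^ CARD('n)"
  proof (rule card_separated_points_le)
    fix u v assume "u \<in> insert 0 W" "v \<in> insert 0 W" "u \<noteq> v"
    then show "1 \<le> dist u v"
      using assms(2) int_vecs_norm_diff_ge_1[of u v] by (auto simp: dist_norm int_vecs_def)
  qed (use assms in auto)
  moreover have "card (insert 0 W) = card W + 1"
    using assms(1,2) by (subst card_insert_disjoint) auto
  ultimately show ?thesis
    using power_two_mul_plus_one_minus_one_le[OF \<open>m \<ge> 1\<close>, of "CARD('n)"] by simp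
qed

definition lattice_ball_const :: "'n::finite itself \<Rightarrow> real" where
  "lattice_ball_const n = 2 * real CARD('n) * 3 ^ (CARD('n) - 1) / omega n"

lemma lattice_ball_const_nonneg: "0 \<le> lattice_ball_const TYPE('n::finite)"
  using omega_pos[where 'n='n] by (simp add: lattice_ball_const_def)

lemma card_nonzero_int_vecs_le_volume:
  fixes U :: "(real^'n) set"
  assumes star: "\<And>x y. x \<in> U \<Longrightarrow> norm y \<le> norm x \<Longrightarrow> y \<in> U" and "U \<in> sets borel"
    and "finite W" "W \<subseteq> U \<inter> (int_vecs - {0})"
  shows "ennreal (card W) \<le> lattice_ball_const TYPE('n) * emeasure lborel U"
proof (cases "W = {}")
  case False
  define m where "m = Max (norm ` W)"
  have "m \<in> norm ` W"
    using \<open>finite W\<close> False unfolding m_def by (intro Max_in) auto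
  then obtain w where w: "w \<in> W" "norm w = m"
    by auto
  have "W \<subseteq> cball 0 m"
    using \<open>finite W\<close> by (auto simp: m_def)
  have "1 \<le> m"
    using w int_vecs_norm_diff_ge_1[of w 0] assms(4) by (auto simp: int_vecs_def)
  have "cball 0 m \<subseteq> U"
    using star[of w] w assms(4) by auto
  have "real (card W) \<le> 2 * real CARD('n) * 3 ^ (CARD('n) - 1) * m ^ CARD('n)"
    using card_nonzero_int_vecs_le[OF \<open>finite W\<close> _ \<open>W \<subseteq> cball 0 m\<close> \<open>1 \<le> m\<close>] assms(4) by auto
  also have "\<dots> = lattice_ball_const TYPE('n) * measure lborel (cball (0::real^'n) m)"
    using \<open>1 \<le> m\<close> omega_pos[where 'n='n] by (simp add: lattice_ball_const_def measure_cball_omega)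
  finally have "ennreal (card W) \<le> ennreal (lattice_ball_const TYPE('n) * measure lborel (cball (0::real^'n) m))"
    by (rule ennreal_leI)
  also have "\<dots> = lattice_ball_const TYPE('n) * emeasure lborel (cball (0::real^'n) m)"
    using emeasure_lborel_cball_finite[of "0::real^'n" m]
    by (simp add: lattice_ball_const_nonneg ennreal_mult emeasure_eq_ennreal_measure)
  also have "\<dots> \<le> lattice_ball_const TYPE('n) * emeasure lborel U"
    using \<open>cball 0 m \<subseteq> U\<close> \<open>U \<in> sets borel\<close> by (intro mult_left_mono emeasure_mono) auto
  finally show ?thesis .
qed simp

lemma emeasure_nonzero_int_vecs_le_volume:
  fixes U :: "(real^'n) set"
  assumes star: "\<And>x y. x \<in> U \<Longrightarrow> norm y \<le> norm x \<Longrightarrow> y \<in> U" and "U \<in> sets borel"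
  shows "emeasure (count_space (int_vecs - {0})) (U \<inter> (int_vecs - {0}))
           \<le> lattice_ball_const TYPE('n) * emeasure lborel U"
proof (cases "finite (U \<inter> (int_vecs - {0}))")
  case True
  then show ?thesis
    using card_nonzero_int_vecs_le_volume[OF star \<open>U \<in> sets borel\<close> True order.refl]
    by (simp add: emeasure_count_space ennreal_of_nat_eq_real_of_nat)
next
  case False
  have "lattice_ball_const TYPE('n) * emeasure lborel U = \<infinity>"
  proof (rule ccontr)
    assume "lattice_ball_const TYPE('n) * emeasure lborel U \<noteq> \<infinity>"
    then obtain x where x: "lattice_ball_const TYPE('n) * emeasure lborel U = ennreal x" "0 \<le> x"
      using ennreal_cases[of "lattice_ball_const TYPE('n) * emeasure lborel U"] by auto
    obtain W where W: "finite W" "card W = nat \<lceil>x\<rceil> + 1" "W \<subseteq> U \<inter> (int_vecs - {0})"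
      using infinite_arbitrarily_large[OF False] by blast
    have "ennreal (card W) \<le> ennreal x"
      using card_nonzero_int_vecs_le_volume[OF star \<open>U \<in> sets borel\<close> W(1,3)] x(1) by simp
    then have "real (card W) \<le> x"
      using x(2) by (simp add: ennreal_le_iff)
    with W(2) show False
      by linarith
  qed
  then show ?thesis
    by simp
qed

lemma nn_integral_layer_cake:
  fixes G :: "'a \<Rightarrow> real"
  assumes "sigma_finite_measure M" and [measurable]: "G \<in> borel_measurable M"
    and nonneg: "\<And>x. 0 \<le> G x"
  shows "(\<integral>\<^sup>+x. ennreal (G x) \<partial>M) = (\<integral>\<^sup>+t. indicator {0..} t * emeasure M {x \<in> space M. t < G x} \<partial>lborel)"
proof -
  interpret pair_sigma_finite lborel M
    by (intro pair_sigma_finite.intro lborel.sigma_finite_measure_axioms assms(1))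
  have meas: "(\<lambda>(t, x). indicator {0..} t * indicator {x \<in> space M. t < G x} x :: ennreal)
      \<in> borel_measurable (lborel \<Otimes>\<^sub>M M)"
    by measurable
  have "(\<integral>\<^sup>+x. ennreal (G x) \<partial>M) = (\<integral>\<^sup>+x. \<integral>\<^sup>+t. indicator {0..} t * indicator {x \<in> space M. t < G x} x \<partial>lborel \<partial>M)"
  proof (rule nn_integral_cong)
    fix x assume "x \<in> space M"
    then have "(\<integral>\<^sup>+t. indicator {0..} t * indicator {x \<in> space M. t < G x} x \<partial>lborel) = emeasure lborel {0..<G x}"
      by (auto intro!: nn_integral_cong simp: indicator_def simp flip: nn_integral_indicator)
    then show "ennreal (G x) = (\<integral>\<^sup>+t. indicator {0..} t * indicator {x \<in> space M. t < G x} x \<partial>lborel)"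
      using nonneg[of x] by simp
  qed
  also have "\<dots> = (\<integral>\<^sup>+t. \<integral>\<^sup>+x. indicator {0..} t * indicator {x \<in> space M. t < G x} x \<partial>M \<partial>lborel)"
    by (rule Fubini'[OF meas])
  also have "\<dots> = (\<integral>\<^sup>+t. indicator {0..} t * emeasure M {x \<in> space M. t < G x} \<partial>lborel)"
    by (simp add: nn_integral_cmult_indicator)
  finally show ?thesis .
qed

lemma nn_integral_nonzero_int_vecs_le:
  fixes G :: "real^'n \<Rightarrow> real"
  assumes [measurable]: "G \<in> borel_measurable borel" and nonneg: "\<And>x. 0 \<le> G x"
    and radial: "\<And>x y. norm y \<le> norm x \<Longrightarrow> G x \<le> G y"
  shows "(\<integral>\<^sup>+u. G u \<partial>count_space (int_vecs - {0}))
           \<le> lattice_ball_const TYPE('n) * (\<integral>\<^sup>+x. G x \<partial>lborel)"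
proof -
  let ?Z = "int_vecs - {0} :: (real^'n) set"
  have "sigma_finite_measure (count_space ?Z)"
    using countable_int_vecs by (intro sigma_finite_measure_count_space_countable) auto
  then have "(\<integral>\<^sup>+u. G u \<partial>count_space ?Z) = (\<integral>\<^sup>+t. indicator {0..} t * emeasure (count_space ?Z) {u \<in> ?Z. t < G u} \<partial>lborel)"
    using nonneg by (subst nn_integral_layer_cake) auto
  also have "\<dots> \<le> (\<integral>\<^sup>+t. lattice_ball_const TYPE('n) * (indicator {0..} t * emeasure lborel {x. t < G x}) \<partial>lborel)"
  proof (rule nn_integral_mono)
    fix t :: real
    have "emeasure (count_space ?Z) ({x. t < G x} \<inter> ?Z) \<le> lattice_ball_const TYPE('n) * emeasure lborel {x. t < G x}"
      using radial by (intro emeasure_nonzero_int_vecs_le_volume) (auto intro: less_le_trans)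
    then show "indicator {0..} t * emeasure (count_space ?Z) {u \<in> ?Z. t < G u}
        \<le> lattice_ball_const TYPE('n) * (indicator {0..} t * emeasure lborel {x. t < G x})"
      by (auto simp: indicator_def Int_def conj_commute)
  qed
  also have "\<dots> = lattice_ball_const TYPE('n) * (\<integral>\<^sup>+x. G x \<partial>lborel)"
    using nonneg by (simp add: nn_integral_cmult nn_integral_layer_cake[OF lborel.sigma_finite_measure_axioms])
  finally show ?thesis .
qed

lemma emeasure_UN_countable_le:
  assumes "\<And>i. i \<in> I \<Longrightarrow> X i \<in> sets M" "countable I"
  shows "emeasure M (\<Union>i\<in>I. X i) \<le> (\<integral>\<^sup>+i. emeasure M (X i) \<partial>count_space I)"
proof -
  have "(\<Union>i\<in>I. X i) \<in> sets M"
    using assms by (intro sets.countable_UN') auto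
  then have "emeasure M (\<Union>i\<in>I. X i) = (\<integral>\<^sup>+x. indicator (\<Union>i\<in>I. X i) x \<partial>M)"
    by simp
  also have "\<dots> \<le> (\<integral>\<^sup>+x. \<integral>\<^sup>+i. indicator (X i) x \<partial>count_space I \<partial>M)"
  proof (intro nn_integral_mono)
    fix x
    show "indicator (\<Union>i\<in>I. X i) x \<le> (\<integral>\<^sup>+i. indicator (X i) x \<partial>count_space I)"
    proof (cases "x \<in> (\<Union>i\<in>I. X i)")
      case True
      then obtain j where "j \<in> I" "x \<in> X j"
        by auto
      then have "(1::ennreal) = (\<integral>\<^sup>+i. indicator (X i) x * indicator {j} i \<partial>count_space I)"
        by (subst nn_integral_indicator_singleton) auto
      also have "\<dots> \<le> (\<integral>\<^sup>+i. indicator (X i) x \<partial>count_space I)"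
        by (intro nn_integral_mono) (simp add: indicator_def)
      finally show ?thesis
        using True by simp
    qed simp
  qed
  also have "\<dots> = (\<integral>\<^sup>+i. \<integral>\<^sup>+x. indicator (X i) x \<partial>M \<partial>count_space I)"
    using assms by (intro nn_integral_count_space_nn_integral) auto
  also have "\<dots> = (\<integral>\<^sup>+i. emeasure M (X i) \<partial>count_space I)"
    using assms by (intro nn_integral_cong) simp
  finally show ?thesis .
qed

section \<open>Haar measure on the orthogonal group\<close>

lemma nn_integral_indicator_comp_distr:
  assumes "sets M = sets borel" "f \<in> borel_measurable borel" "B \<in> sets borel"
  shows "(\<integral>\<^sup>+x. indicator B (f x) \<partial>M) = emeasure (distr M borel f) B"
proof -
  have f: "f \<in> M \<rightarrow>\<^sub>M borel"
    using assms(2) by (simp add: measurable_cong_sets[OF assms(1) refl])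
  then show ?thesis
    using assms(3) by (simp add: nn_integral_distr[OF f, symmetric])
qed

lemma distr_transpose_mult_right:
  fixes M :: "(real^'n^'n) measure"
  assumes "sets M = sets borel"
  shows "distr (distr M borel transpose) borel (\<lambda>R. R ** Q)
           = distr (distr M borel (\<lambda>R. transpose Q ** R)) borel transpose"
proof -
  have [measurable]: "transpose \<in> M \<rightarrow>\<^sub>M borel" "(\<lambda>R. transpose Q ** R) \<in> M \<rightarrow>\<^sub>M borel"
    by (simp_all add: measurable_cong_sets[OF assms refl])
  have "distr (distr M borel transpose) borel (\<lambda>R. R ** Q) = distr M borel ((\<lambda>R. R ** Q) \<circ> transpose)"
    by (simp add: distr_distr)
  also have "\<dots> = distr M borel (transpose \<circ> (\<lambda>R. transpose Q ** R))"
    by (simp add: o_def matrix_transpose_mul)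
  also have "\<dots> = distr (distr M borel (\<lambda>R. transpose Q ** R)) borel transpose"
    by (simp add: distr_distr)
  finally show ?thesis .
qed

text \<open>The classical uniqueness argument: integrate indicator B (R ** S) over \<nu> \<Otimes> \<mu> in both orders.\<close>

lemma left_right_invariant_measures_eq:
  fixes \<mu> \<nu> :: "(real^'n^'n) measure"
  assumes "prob_space \<mu>" "prob_space \<nu>" and sets: "sets \<mu> = sets borel" "sets \<nu> = sets borel"
    and ae: "AE R in \<mu>. orthogonal_matrix R" "AE R in \<nu>. orthogonal_matrix R"
    and left: "\<And>Q. orthogonal_matrix Q \<Longrightarrow> distr \<mu> borel (\<lambda>R. Q ** R) = \<mu>"
    and right: "\<And>Q. orthogonal_matrix Q \<Longrightarrow> distr \<nu> borel (\<lambda>R. R ** Q) = \<nu>"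
  shows "\<mu> = \<nu>"
proof (rule measure_eqI)
  interpret \<mu>: prob_space \<mu> by fact
  interpret \<nu>: prob_space \<nu> by fact
  interpret pair_sigma_finite \<nu> \<mu>
    by (intro pair_sigma_finite.intro \<mu>.sigma_finite_measure_axioms \<nu>.sigma_finite_measure_axioms)
  show "sets \<mu> = sets \<nu>"
    using sets by simp
  fix B assume "B \<in> sets \<mu>"
  then have B: "B \<in> sets borel"
    using sets by simp
  have "(\<lambda>(R, S). indicator B (R ** S) :: ennreal) \<in> borel_measurable (\<nu> \<Otimes>\<^sub>M \<mu>)"
    using B by (simp add: measurable_cong_sets[OF sets_pair_measure_cong[OF sets(2,1)]] borel_prod[symmetric] case_prod_beta')
  have "emeasure \<nu> B = (\<integral>\<^sup>+S. emeasure \<nu> B \<partial>\<mu>)"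
    by (simp add: \<mu>.emeasure_space_1)
  also have "\<dots> = (\<integral>\<^sup>+S. \<integral>\<^sup>+R. indicator B (R ** S) \<partial>\<nu> \<partial>\<mu>)"
    using ae(1) by (intro nn_integral_cong_AE)
      (auto elim!: AE_mp simp: nn_integral_indicator_comp_distr[OF sets(2) _ B] right)
  also have "\<dots> = (\<integral>\<^sup>+R. \<integral>\<^sup>+S. indicator B (R ** S) \<partial>\<mu> \<partial>\<nu>)"
    by (rule Fubini') fact
  also have "\<dots> = (\<integral>\<^sup>+R. emeasure \<mu> B \<partial>\<nu>)"
    using ae(2) by (intro nn_integral_cong_AE)
      (auto elim!: AE_mp simp: nn_integral_indicator_comp_distr[OF sets(1) _ B] left)
  finally show "emeasure \<mu> B = emeasure \<nu> B"
    by (simp add: \<nu>.emeasure_space_1)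
qed

context
  fixes P :: "(real^'n^'n) measure"
  assumes haar: "haar_orthogonal P"
begin

lemma haar_prob_space: "prob_space P"
  using haar by (simp add: haar_orthogonal_def)

lemma sets_haar [measurable_cong]: "sets P = sets borel"
  using haar by (simp add: haar_orthogonal_def)

lemma space_haar: "space P = UNIV"
  using sets_eq_imp_space_eq[OF sets_haar] by simp

lemma AE_haar_orthogonal: "AE R in P. orthogonal_matrix R"
proof -
  interpret prob_space P by (rule haar_prob_space)
  show ?thesis
    using haar AE_prob_1[of "{R. orthogonal_matrix R}"] by (simp add: haar_orthogonal_def)
qed

lemma haar_left_invariant: "orthogonal_matrix Q \<Longrightarrow> distr P borel (\<lambda>R. Q ** R) = P"
  using haar by (simp add: haar_orthogonal_def)

text \<open>Transposition turns left invariance into right invariance.\<close>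

lemma haar_distr_transpose: "distr P borel transpose = P"
proof (rule left_right_invariant_measures_eq[symmetric])
  show "prob_space P" "prob_space (distr P borel transpose)"
    by (simp_all add: haar_prob_space prob_space.prob_space_distr)
  show "AE R in P. orthogonal_matrix R" "AE R in distr P borel transpose. orthogonal_matrix R"
    using AE_haar_orthogonal by (simp_all add: AE_distr_iff orthogonal_matrix_transpose)
  fix Q :: "real^'n^'n"
  assume "orthogonal_matrix Q"
  then show "distr P borel (\<lambda>R. Q ** R) = P"
    by (rule haar_left_invariant)
  show "distr (distr P borel transpose) borel (\<lambda>R. R ** Q) = distr P borel transpose"
    using \<open>orthogonal_matrix Q\<close>
    by (simp add: distr_transpose_mult_right sets_haar haar_left_invariant orthogonal_matrix_transpose)
qed (simp_all add: sets_haar)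

lemma haar_right_invariant: "orthogonal_matrix Q \<Longrightarrow> distr P borel (\<lambda>R. R ** Q) = P"
  using distr_transpose_mult_right[OF sets_haar, of Q]
  by (simp add: haar_distr_transpose haar_left_invariant orthogonal_matrix_transpose)

lemma measurable_haar_iff: "f \<in> P \<rightarrow>\<^sub>M N \<longleftrightarrow> f \<in> borel \<rightarrow>\<^sub>M N"
  by (simp add: measurable_cong_sets[OF sets_haar refl])

lemma measure_haar_hit_rotate:
  assumes "E \<in> sets borel" "orthogonal_matrix T"
  shows "measure P {R. R *v (T *v y) \<in> E} = measure P {R. R *v y \<in> E}"
proof -
  have "{R. R *v (T *v y) \<in> E} = (\<lambda>R. R ** T) -` {R. R *v y \<in> E} \<inter> space P"
    by (auto simp: space_haar matrix_vector_mul_assoc)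
  also have "measure P \<dots> = measure (distr P borel (\<lambda>R. R ** T)) {R. R *v y \<in> E}"
    using assms(1) by (intro measure_distr[symmetric]) (simp_all add: measurable_haar_iff)
  finally show ?thesis
    using assms(2) by (simp add: haar_right_invariant)
qed

lemma measure_haar_hit_antimono:
  assumes "E \<in> sets borel" and balanced: "\<And>x t. x \<in> E \<Longrightarrow> \<bar>t\<bar> \<le> 1 \<Longrightarrow> t *\<^sub>R x \<in> E"
    and "norm y \<le> norm x"
  shows "measure P {R. R *v x \<in> E} \<le> measure P {R. R *v y \<in> E}"
proof (cases "x = 0")
  case False
  define z where "z = (norm y / norm x) *\<^sub>R x"
  have "{R. R *v x \<in> E} \<subseteq> {R. R *v z \<in> E}"
    using balanced assms(3) False by (auto simp: z_def matrix_vector_mult_scaleR)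
  then have "measure P {R. R *v x \<in> E} \<le> measure P {R. R *v z \<in> E}"
    using assms(1) haar_prob_space by (intro finite_measure.finite_measure_mono) (auto intro: prob_space.finite_measure)
  moreover obtain f where "orthogonal_transformation f" "f z = y"
    using orthogonal_transformation_exists[of z y] False by (auto simp: z_def)
  then have "orthogonal_matrix (matrix f)" "matrix f *v z = y"
    by (auto simp: orthogonal_transformation_matrix matrix_works orthogonal_transformation_linear)
  ultimately show ?thesis
    using measure_haar_hit_rotate[OF assms(1)] by metis
qed (use assms(3) in simp)

lemma nn_integral_haar_hit:
  assumes "E \<in> sets borel"
  shows "(\<integral>\<^sup>+x. emeasure P {R. R *v x \<in> E} \<partial>lborel) = (\<integral>\<^sup>+R. emeasure lborel {x. R *v x \<in> E} \<partial>P)"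
proof -
  interpret prob_space P
    by (rule haar_prob_space)
  interpret pair_sigma_finite lborel P
    by (intro pair_sigma_finite.intro lborel.sigma_finite_measure_axioms sigma_finite_measure_axioms)
  have "(\<lambda>(x, R). indicator E (R *v x) :: ennreal) \<in> borel_measurable (lborel \<Otimes>\<^sub>M borel)"
    using assms by measurable
  then have "(\<lambda>(x, R). indicator E (R *v x) :: ennreal) \<in> borel_measurable (lborel \<Otimes>\<^sub>M P)"
    by (simp add: measurable_cong_sets[OF sets_pair_measure_cong[OF refl sets_haar] refl])
  then have "(\<integral>\<^sup>+x. \<integral>\<^sup>+R. indicator E (R *v x) \<partial>P \<partial>lborel) = (\<integral>\<^sup>+R. \<integral>\<^sup>+x. indicator E (R *v x) \<partial>lborel \<partial>P)"
    by (rule Fubini'[symmetric])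
  then show ?thesis
    using assms by (simp add: nn_integral_indicator[symmetric] indicator_def of_bool_def)
qed

lemma borel_measurable_haar_hit [measurable]:
  assumes [measurable]: "E \<in> sets borel"
  shows "(\<lambda>x. measure P {R. R *v x \<in> E}) \<in> borel_measurable borel"
proof -
  interpret prob_space P
    by (rule haar_prob_space)
  have sets_eq: "sets (borel \<Otimes>\<^sub>M P) = sets (borel \<Otimes>\<^sub>M borel)"
    by (rule sets_pair_measure_cong[OF refl sets_haar])
  have "{z \<in> space (borel \<Otimes>\<^sub>M borel). snd z \<in> {R. R *v fst z \<in> E}} \<in> sets (borel \<Otimes>\<^sub>M borel)"
    by measurable
  then have "{z \<in> space (borel \<Otimes>\<^sub>M P). snd z \<in> {R. R *v fst z \<in> E}} \<in> sets (borel \<Otimes>\<^sub>M P)"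
    unfolding sets_eq sets_eq_imp_space_eq[OF sets_eq] .
  then show ?thesis
    by (intro measurable_measure) (simp_all add: space_haar)
qed

section \<open>Probability of a short lattice vector\<close>

lemma emeasure_haar_lattice_hit_ellipsoid:
  assumes "sym_posdef A" "det A = 1" "r > 0"
  shows "emeasure P (\<Union>u\<in>int_vecs - {0}. {R. R *v u \<in> ellipsoid A r})
           \<le> 2 * real CARD('n) * 3 ^ (CARD('n) - 1) * r ^ CARD('n)"
proof -
  interpret prob_space P
    by (rule haar_prob_space)
  let ?E = "ellipsoid A r" and ?Z = "int_vecs - {0} :: (real^'n) set"
  have "emeasure P (\<Union>u\<in>?Z. {R. R *v u \<in> ?E}) \<le> (\<integral>\<^sup>+u. emeasure P {R. R *v u \<in> ?E} \<partial>count_space ?Z)"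
    using countable_int_vecs by (intro emeasure_UN_countable_le) auto
  also have "\<dots> = (\<integral>\<^sup>+u. measure P {R. R *v u \<in> ?E} \<partial>count_space ?Z)"
    by (simp add: emeasure_eq_measure)
  also have "\<dots> \<le> lattice_ball_const TYPE('n) * (\<integral>\<^sup>+x. measure P {R. R *v x \<in> ?E} \<partial>lborel)"
    using measure_haar_hit_antimono[OF ellipsoid_borel scaleR_mem_ellipsoid[OF assms(1)]]
    by (intro nn_integral_nonzero_int_vecs_le) auto
  also have "(\<integral>\<^sup>+x. measure P {R. R *v x \<in> ?E} \<partial>lborel) = (\<integral>\<^sup>+R. emeasure lborel {x. R *v x \<in> ?E} \<partial>P)"
    using nn_integral_haar_hit[OF ellipsoid_borel] by (simp add: emeasure_eq_measure)
  also have "\<dots> = (\<integral>\<^sup>+R. r ^ CARD('n) * omega TYPE('n) \<partial>P)"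
  proof (rule nn_integral_cong_AE)
    show "AE R in P. emeasure lborel {x. R *v x \<in> ?E} = ennreal (r ^ CARD('n) * omega TYPE('n))"
      using AE_haar_orthogonal
    proof eventually_elim
      case (elim R)
      have "{x. R *v x \<in> ?E} = ellipsoid (transpose R ** A ** R) r"
        using vimage_ellipsoid[of R A r] by (simp add: vimage_def)
      then show ?case
        using sym_posdef_orthogonal_congruence[OF assms(1) elim] assms by (simp add: emeasure_ellipsoid)
    qed
  qed
  also have "lattice_ball_const TYPE('n) * \<dots> = 2 * real CARD('n) * 3 ^ (CARD('n) - 1) * r ^ CARD('n)"
    using omega_pos[where 'n='n] assms(3)
    by (simp add: emeasure_space_1 lattice_ball_const_def ennreal_mult'[symmetric])
  finally show ?thesis .
qed

end

lemma lambda1_le_imp_short_int_vec: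
  fixes M :: "real^'n^'n"
  assumes "lambda1 M \<le> \<delta>" "\<delta> < r"
  obtains u where "u \<in> int_vecs" "u \<noteq> 0" "u \<bullet> (M *v u) \<le> r\<^sup>2"
proof -
  obtain i :: 'n where True
    by simp
  then have "axis i 1 \<in> {u. u \<in> int_vecs \<and> u \<noteq> 0}"
    by (simp add: int_vecs_def axis_def axis_eq_0_iff[of i 1, unfolded axis_def])
  then have ne: "{mnorm M u | u. u \<in> int_vecs \<and> u \<noteq> 0} \<noteq> {}"
    by blast
  have lt: "Inf {mnorm M u | u. u \<in> int_vecs \<and> u \<noteq> 0} < r"
    using assms by (simp add: lambda1_def)
  obtain v where "v \<in> {mnorm M u | u. u \<in> int_vecs \<and> u \<noteq> 0}" "v < r"
    using cInf_lessD[OF ne lt] by blast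
  then obtain u where u: "u \<in> int_vecs" "u \<noteq> 0" "sqrt (u \<bullet> (M *v u)) < r"
    by (auto simp: mnorm_def)
  moreover have "u \<bullet> (M *v u) \<le> r\<^sup>2"
  proof (cases "u \<bullet> (M *v u) < 0")
    case False
    then have "(sqrt (u \<bullet> (M *v u)))\<^sup>2 < r\<^sup>2"
      using u(3) by (intro power_strict_mono) auto
    with False show ?thesis
      by simp
  qed (use zero_le_power2[of r] in linarith)
  ultimately show ?thesis
    using that by blast
qed

lemma le_mult_power_of_forall_gt:
  fixes x c \<delta> :: real
  assumes "\<And>r. \<delta> < r \<Longrightarrow> x \<le> c * r ^ n"
  shows "x \<le> c * \<delta> ^ n"
proof (rule tendsto_lowerbound)
  show "((\<lambda>r. c * r ^ n) \<longlongrightarrow> c * \<delta> ^ n) (at_right \<delta>)"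
    by (intro tendsto_intros)
  show "\<forall>\<^sub>F r in at_right \<delta>. x \<le> c * r ^ n"
    using eventually_at_right_less by (rule eventually_mono) (rule assms)
qed simp

lemma omega_le_2_pow: "omega TYPE('n::finite) \<le> 2 ^ CARD('n)"
proof -
  have "ball (0::real^'n) 1 \<subseteq> cbox (- 1) 1"
  proof
    fix x :: "real^'n"
    assume "x \<in> ball 0 1"
    then have "\<bar>x $ i\<bar> \<le> 1" for i
      using component_le_norm_cart[of x i] by simp
    then show "x \<in> cbox (- 1) 1"
      by (auto simp: mem_box_cart abs_le_iff)
  qed
  then have "omega TYPE('n) \<le> measure lborel (cbox (- 1) (1::real^'n))"
    unfolding omega_def by (intro measure_mono_fmeasurable) auto
  also have "\<dots> = 2 ^ CARD('n)"
  proof -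
    have "(0::real^'n) \<in> cbox (- 1) 1"
      by (simp add: mem_box_cart)
    then show ?thesis
      using content_cbox_cart[of "- 1" "1::real^'n"] by auto
  qed
  finally show ?thesis .
qed

lemma C'_const_ge: "2 * real CARD('n) * 3 ^ (CARD('n) - 1) \<le> C'_const TYPE('n::finite)"
proof -
  have "1 \<le> C_const TYPE('n)"
    using omega_le_2_pow[where 'n='n] omega_pos[where 'n='n] by (simp add: C_const_def)
  then show ?thesis
    unfolding C'_const_def using mult_left_mono[of 1 "C_const TYPE('n)" "2 * real CARD('n) * 3 ^ (CARD('n) - 1)"]
    by simp
qed

theorem corollary2p2:
  fixes A :: "real^'n^'n" and P :: "(real^'n^'n) measure" and \<delta> :: real
  assumes "sym_posdef A" and "det A = 1"
    and "haar_orthogonal P"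
    and "\<delta> > 0"
  shows "measure P {R. lambda1 (transpose R ** A ** R) \<le> \<delta>}
           \<le> C'_const TYPE('n) * \<delta> ^ CARD('n)"
proof -
  interpret prob_space P
    using assms(3) by (rule haar_prob_space)
  define K where "K = 2 * real CARD('n) * 3 ^ (CARD('n) - 1)"
  let ?T = "{R. lambda1 (transpose R ** A ** R) \<le> \<delta>}"
  have "measure P ?T \<le> K * r ^ CARD('n)" if "\<delta> < r" for r
  proof -
    let ?U = "\<Union>u\<in>int_vecs - {0}. {R. R *v u \<in> ellipsoid A r}"
    have "?T \<subseteq> ?U"
      using \<open>\<delta> < r\<close> by (auto simp: ellipsoid_def inner_congruence elim!: lambda1_le_imp_short_int_vec)
    moreover have "?U \<in> sets P"
      using countable_int_vecs assms(3) by (intro sets.countable_UN') (auto simp: sets_haar)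
    ultimately have "measure P ?T \<le> measure P ?U"
      by (rule finite_measure_mono)
    also have "\<dots> \<le> K * r ^ CARD('n)"
      using emeasure_haar_lattice_hit_ellipsoid[OF assms(3,1,2)] \<open>\<delta> < r\<close> assms(4)
      by (simp add: K_def emeasure_eq_measure)
    finally show ?thesis .
  qed
  then have "measure P ?T \<le> K * \<delta> ^ CARD('n)"
    by (rule le_mult_power_of_forall_gt)
  also have "\<dots> \<le> C'_const TYPE('n) * \<delta> ^ CARD('n)"
    using C'_const_ge assms(4) unfolding K_def by (intro mult_right_mono) auto
  finally show ?thesis .
qed

end
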